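(* Let $n,m\ge 1$, let $C_0,\dots,C_m$ and $C'_0,\dots,C'_m$ be $n$-qubit Clifford gates, let $k_1,\dots,k_m,l_1,\dots,l_m\in\{1,\dots,n\}$, and let $F,F':\mathcal U_2^m\to\mathcal U_{2^n}$ be the associated circuit functions defined in the context. Suppose there exists a constant $\phi\in\mathbb R$ such that $$F'(\vec P)=e^{i\phi}F(\vec P)\quad\text{for all }\vec P\in\mathcal P^m$$ (with the same $\phi$ for all $\vec P$). Then, for any fixed assignment $\vec U\in\mathcal U_2^m$, $$F'(\vec U)=e^{i\phi}F(\vec U).$$ In particular, this equality holds for some $\vec U\in\mathcal U_2^m$.
   Context: $\mathcal U_d$ denotes the set of $d\times d$ unitary matrices, and $\mathcal P=\{I,X,Y,Z\}\subset\mathcal U_2$ the set of single-qubit Pauli matrices. For a $2\times 2$ matrix $A$ and $1\le k\le n$, $A^{(k)}:=I^{\otimes(k-1)}\otimes A\otimes I^{\otimes(n-k)}$. An $n$-qubit Clifford gate is a unitary $C\in\mathcal U_{2^n}$ such that conjugation $Q\mapsto CQC^\dagger$ maps every Pauli string (tensor product of $n$ elements of $\mathcal P$) to $\pm$ a Pauli string. For $\vec U=(U_1,\dots,U_m)$, $$F(\vec U)=C_mU_m^{(k_m)}C_{m-1}U_{m-1}^{(k_{m-1})}\cdots C_1U_1^{(k_1)}C_0,\qquad F'(\vec U)=C'_mU_m^{(l_m)}C'_{m-1}U_{m-1}^{(l_{m-1})}\cdots C'_1U_1^{(l_1)}C'_0 .$$ *)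

theory Defs
  imports Jordan_Normal_Form.Schur_Decomposition "HOL-Library.FuncSet"
begin

definition unitary_matrices :: "nat \<Rightarrow> complex mat set" where
  "unitary_matrices d =
     {U \<in> carrier_mat d d. U * mat_adjoint U = 1\<^sub>m d \<and> mat_adjoint U * U = 1\<^sub>m d}"

definition pauli_X :: "complex mat" where
  "pauli_X = mat_of_rows_list 2 [[0, 1], [1, 0]]"

definition pauli_Y :: "complex mat" where
  "pauli_Y = mat_of_rows_list 2 [[0, - \<i>], [\<i>, 0]]"

definition pauli_Z :: "complex mat" where
  "pauli_Z = mat_of_rows_list 2 [[1, 0], [0, - 1]]"

definition paulis :: "complex mat set" where
  "paulis = {1\<^sub>m 2, pauli_X, pauli_Y, pauli_Z}"

text \<open>The Kronecker product; the row and column indices of the left factor are the most significant.\<close>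

definition kron :: "complex mat \<Rightarrow> complex mat \<Rightarrow> complex mat" (infixr "\<otimes>\<^sub>K" 75) where
  "A \<otimes>\<^sub>K B = mat (dim_row A * dim_row B) (dim_col A * dim_col B)
     (\<lambda>(i, j). A $$ (i div dim_row B, j div dim_col B) * B $$ (i mod dim_row B, j mod dim_col B))"

definition kron_list :: "complex mat list \<Rightarrow> complex mat" where
  "kron_list As = foldr kron As (1\<^sub>m 1)"

definition pauli_strings :: "nat \<Rightarrow> complex mat set" where
  "pauli_strings n = {kron_list Ps | Ps. length Ps = n \<and> set Ps \<subseteq> paulis}"

text \<open>\<open>on_qubit n k A\<close> is the gate \<open>A\<close> acting on qubit \<open>k\<close> of \<open>n\<close>.  Qubits are numbered from 1;
  the definition is only meaningful for \<open>1 \<le> k \<le> n\<close>.\<close>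

definition on_qubit :: "nat \<Rightarrow> nat \<Rightarrow> complex mat \<Rightarrow> complex mat" where
  "on_qubit n k A = kron_list (replicate (k - 1) (1\<^sub>m 2) @ [A] @ replicate (n - k) (1\<^sub>m 2))"

definition clifford_gates :: "nat \<Rightarrow> complex mat set" where
  "clifford_gates n = {C \<in> unitary_matrices (2 ^ n).
     \<forall>Q \<in> pauli_strings n. \<exists>Q' \<in> pauli_strings n.
       C * Q * mat_adjoint C = Q' \<or> C * Q * mat_adjoint C = - Q'}"

text \<open>\<open>circuit n m C k U\<close> is the product
  \<open>C m * on_qubit n (k m) (U m) * C (m - 1) * \<dots> * C 1 * on_qubit n (k 1) (U 1) * C 0\<close>.
  It depends only on the values of \<open>C\<close> on \<open>{0..m}\<close> and of \<open>k\<close> and \<open>U\<close> on \<open>{1..m}\<close>.\<close>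

primrec circuit :: "nat \<Rightarrow> nat \<Rightarrow> (nat \<Rightarrow> complex mat) \<Rightarrow> (nat \<Rightarrow> nat) \<Rightarrow> (nat \<Rightarrow> complex mat) \<Rightarrow> complex mat"
where
  "circuit n 0 C k U = C 0"
| "circuit n (Suc m) C k U = C (Suc m) * on_qubit n (k (Suc m)) (U (Suc m)) * circuit n m C k U"

end

theory Submission
  imports Defs
begin

text \<open>A circuit is linear in each of its single-qubit gates, and the Pauli matrices span the
  2 by 2 complex matrices. So the identity extends from Pauli gates to arbitrary matrices one slot
  at a time.\<close>

section \<open>Kronecker products: entries and bilinearity\<close>

lemma dim_kron [simp]:
  "dim_row (A \<otimes>\<^sub>K B) = dim_row A * dim_row B"
  "dim_col (A \<otimes>\<^sub>K B) = dim_col A * dim_col B"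
  by (simp_all add: kron_def)

lemma kron_carrier:
  "A \<in> carrier_mat a b \<Longrightarrow> B \<in> carrier_mat c d \<Longrightarrow> A \<otimes>\<^sub>K B \<in> carrier_mat (a * c) (b * d)"
  by auto

text \<open>The bounds accompany the entry formula because entries of sums and scalar multiples of a
  factor can be evaluated only at indices known to lie in range. The bounds on remainders need
  \<open>c\<close> and \<open>d\<close> positive, which \<open>i < a * c\<close> and
  \<open>j < b * d\<close> force.\<close>

lemma index_kron:
  assumes "A \<in> carrier_mat a b" "B \<in> carrier_mat c d" "i < a * c" "j < b * d"
  shows "(A \<otimes>\<^sub>K B) $$ (i, j) = A $$ (i div c, j div d) * B $$ (i mod c, j mod d)"
    and "i div c < a" "j div d < b" "i mod c < c" "j mod d < d"
  using assms by (auto simp: kron_def less_mult_imp_div_less intro!: mod_less_divisor gr0I)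

lemma kron_add_left:
  assumes "A \<in> carrier_mat a b" "A' \<in> carrier_mat a b" "B \<in> carrier_mat c d"
  shows "(A + A') \<otimes>\<^sub>K B = A \<otimes>\<^sub>K B + A' \<otimes>\<^sub>K B"
  using assms by (intro eq_matI) (simp_all add: index_kron[of _ a b _ c d] distrib_right)

lemma kron_add_right:
  assumes "A \<in> carrier_mat a b" "B \<in> carrier_mat c d" "B' \<in> carrier_mat c d"
  shows "A \<otimes>\<^sub>K (B + B') = A \<otimes>\<^sub>K B + A \<otimes>\<^sub>K B'"
  using assms by (intro eq_matI) (simp_all add: index_kron[of _ a b _ c d] distrib_left)

lemma kron_smult_left:
  assumes "A \<in> carrier_mat a b" "B \<in> carrier_mat c d"
  shows "(x \<cdot>\<^sub>m A) \<otimes>\<^sub>K B = x \<cdot>\<^sub>m (A \<otimes>\<^sub>K B)"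
  using assms by (intro eq_matI) (simp_all add: index_kron[of _ a b _ c d])

lemma kron_smult_right:
  assumes "A \<in> carrier_mat a b" "B \<in> carrier_mat c d"
  shows "A \<otimes>\<^sub>K (x \<cdot>\<^sub>m B) = x \<cdot>\<^sub>m (A \<otimes>\<^sub>K B)"
  using assms by (intro eq_matI) (simp_all add: index_kron[of _ a b _ c d])

lemma kron_list_simps:
  "kron_list [] = 1\<^sub>m 1" "kron_list (A # As) = A \<otimes>\<^sub>K kron_list As"
  by (simp_all add: kron_list_def)

lemma kron_list_carrier:
  assumes "set As \<subseteq> carrier_mat d d"
  shows "kron_list As \<in> carrier_mat (d ^ length As) (d ^ length As)"
  using assms
proof (induction As)
  case (Cons A As)
  then show ?case
    using kron_carrier[of A d d "kron_list As"] by (simp add: kron_list_simps)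
qed (simp add: kron_list_simps)

text \<open>Induction on the prefix \<open>As\<close>: with no prefix the sum sits in the left
  factor of the outermost product, and each further matrix in front moves it into the right factor,
  so both one-sided distributive laws are used.\<close>

lemma kron_list_add:
  assumes "set As \<subseteq> carrier_mat d d" "set Bs \<subseteq> carrier_mat d d"
    and "A \<in> carrier_mat d d" "A' \<in> carrier_mat d d"
  shows "kron_list (As @ (A + A') # Bs) = kron_list (As @ A # Bs) + kron_list (As @ A' # Bs)"
  using assms(1)
proof (induction As)
  case Nil
  show ?case
    using assms kron_add_left[OF assms(3,4) kron_list_carrier[OF assms(2)]]
    by (simp add: kron_list_simps)
next
  case (Cons D As)
  have K: "kron_list (As @ M # Bs) \<in>
      carrier_mat (d ^ (length As + Suc (length Bs))) (d ^ (length As + Suc (length Bs)))"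
    if "M \<in> carrier_mat d d" for M
    using kron_list_carrier[of "As @ M # Bs" d] Cons.prems assms that by simp
  show ?case
    using Cons kron_add_right[OF _ K[OF assms(3)] K[OF assms(4)], of D d d]
    by (simp add: kron_list_simps)
qed

lemma kron_list_smult:
  assumes "set As \<subseteq> carrier_mat d d" "set Bs \<subseteq> carrier_mat d d" "A \<in> carrier_mat d d"
  shows "kron_list (As @ (x \<cdot>\<^sub>m A) # Bs) = x \<cdot>\<^sub>m kron_list (As @ A # Bs)"
  using assms(1)
proof (induction As)
  case Nil
  show ?case
    using assms kron_smult_left[OF assms(3) kron_list_carrier[OF assms(2)]]
    by (simp add: kron_list_simps)
next
  case (Cons D As)
  have "kron_list (As @ A # Bs) \<in>
      carrier_mat (d ^ (length As + Suc (length Bs))) (d ^ (length As + Suc (length Bs)))"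
    using kron_list_carrier[of "As @ A # Bs" d] Cons.prems assms by simp
  then show ?case
    using Cons kron_smult_right[of D d d "kron_list (As @ A # Bs)"]
    by (simp add: kron_list_simps)
qed

section \<open>Linearity of embedding a single-qubit gate\<close>

lemma on_qubit_carrier:
  assumes "k \<in> {1..n}" "A \<in> carrier_mat 2 2"
  shows "on_qubit n k A \<in> carrier_mat (2 ^ n) (2 ^ n)"
proof -
  let ?As = "replicate (k - 1) (1\<^sub>m 2) @ [A] @ replicate (n - k) (1\<^sub>m 2)"
  \<comment> \<open>The length is (k - 1) + 1 + (n - k). With truncated subtraction on naturals this
    is n because 1 \<le> k \<le> n.\<close>
  have "length ?As = n" "set ?As \<subseteq> carrier_mat 2 2"
    using assms by auto
  then show ?thesis
    unfolding on_qubit_def by (metis kron_list_carrier)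
qed

lemma on_qubit_add:
  assumes "A \<in> carrier_mat 2 2" "B \<in> carrier_mat 2 2"
  shows "on_qubit n k (A + B) = on_qubit n k A + on_qubit n k B"
  unfolding on_qubit_def using assms by (simp add: kron_list_add[of _ 2] set_replicate_conv_if)

lemma on_qubit_smult:
  assumes "A \<in> carrier_mat 2 2"
  shows "on_qubit n k (x \<cdot>\<^sub>m A) = x \<cdot>\<^sub>m on_qubit n k A"
  unfolding on_qubit_def using assms by (simp add: kron_list_smult[of _ 2] set_replicate_conv_if)

section \<open>Multilinearity of circuits in their gates\<close>

lemma circuit_carrier:
  assumes "C \<in> {0..m} \<rightarrow> carrier_mat (2 ^ n) (2 ^ n)" "k \<in> {1..m} \<rightarrow> {1..n}"
    and "U \<in> {1..m} \<rightarrow> carrier_mat 2 2"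
  shows "circuit n m C k U \<in> carrier_mat (2 ^ n) (2 ^ n)"
  using assms
proof (induction m)
  case (Suc m)
  have "circuit n m C k U \<in> carrier_mat (2 ^ n) (2 ^ n)"
    using Suc by (auto simp: Pi_iff)
  moreover have "on_qubit n (k (Suc m)) (U (Suc m)) \<in> carrier_mat (2 ^ n) (2 ^ n)"
    using Suc.prems by (intro on_qubit_carrier) (auto simp: Pi_iff)
  moreover have "C (Suc m) \<in> carrier_mat (2 ^ n) (2 ^ n)"
    using Suc.prems by (auto simp: Pi_iff)
  ultimately show ?case
    by (metis circuit.simps(2) mult_carrier_mat)
qed auto

lemma circuit_upd_outside:
  "m < j \<Longrightarrow> circuit n m C k (U(j := A)) = circuit n m C k U"
  by (induction m) auto

text \<open>Linearity in slot \<open>j\<close> is phrased through function update. By induction on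
  \<open>m\<close>, the slot is either the outermost gate, where the embedding is additive, or lies
  in the inner circuit, where the induction hypothesis applies; matrix multiplication distributes
  over the sum in both cases.\<close>

lemma circuit_upd_add:
  assumes "C \<in> {0..m} \<rightarrow> carrier_mat (2 ^ n) (2 ^ n)" "k \<in> {1..m} \<rightarrow> {1..n}"
    and "U \<in> {1..m} \<rightarrow> carrier_mat 2 2" "j \<in> {1..m}"
    and AB: "A \<in> carrier_mat 2 2" "B \<in> carrier_mat 2 2"
  shows "circuit n m C k (U(j := A + B)) =
    circuit n m C k (U(j := A)) + circuit n m C k (U(j := B))"
  using assms(1-4)
proof (induction m)
  case (Suc m)
  let ?N = "(2::nat) ^ n"
  have C: "C (Suc m) \<in> carrier_mat ?N ?N"
    using Suc.prems by (auto simp: Pi_iff)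
  have G: "on_qubit n (k (Suc m)) M \<in> carrier_mat ?N ?N" if "M \<in> carrier_mat 2 2" for M
    using Suc.prems that by (intro on_qubit_carrier) (auto simp: Pi_iff)
  have F: "circuit n m C k (U(j := M)) \<in> carrier_mat ?N ?N" if "M \<in> carrier_mat 2 2" for M
    using Suc.prems that by (intro circuit_carrier) (auto simp: Pi_iff)
  show ?case
  proof (cases "j = Suc m")
    case True
    \<comment> \<open>The inner circuit reads only slots up to \<open>m\<close>, so \<open>M\<close>
      occurs in the outermost gate alone.\<close>
    have upd: "circuit n (Suc m) C k (U(j := M)) =
        C (Suc m) * on_qubit n (k (Suc m)) M * circuit n m C k U" for M
      by (simp only: True circuit.simps fun_upd_same circuit_upd_outside[OF lessI])
    have "circuit n m C k U \<in> carrier_mat ?N ?N"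
      using Suc.prems by (intro circuit_carrier) (auto simp: Pi_iff)
    then show ?thesis
      using mult_carrier_mat[OF C G[OF AB(1)]] mult_carrier_mat[OF C G[OF AB(2)]]
      by (simp only: upd on_qubit_add[OF AB] mult_add_distrib_mat[OF C G[OF AB(1)] G[OF AB(2)]]
          add_mult_distrib_mat[of _ ?N ?N])
  next
    case False
    \<comment> \<open>Here the outermost gate does not see the update, so \<open>M\<close> occurs in
      the inner circuit alone.\<close>
    then have upd: "circuit n (Suc m) C k (U(j := M)) =
        C (Suc m) * on_qubit n (k (Suc m)) (U (Suc m)) * circuit n m C k (U(j := M))" for M
      by (simp add: fun_upd_other del: fun_upd_apply)
    have IH: "circuit n m C k (U(j := A + B)) =
        circuit n m C k (U(j := A)) + circuit n m C k (U(j := B))"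
      using Suc.prems False by (intro Suc.IH) (auto simp: Pi_iff)
    have D: "C (Suc m) * on_qubit n (k (Suc m)) (U (Suc m)) \<in> carrier_mat ?N ?N"
      using Suc.prems by (intro mult_carrier_mat[OF C] G) (auto simp: Pi_iff)
    show ?thesis
      by (simp only: upd IH mult_add_distrib_mat[OF D F[OF AB(1)] F[OF AB(2)]])
  qed
qed auto

lemma circuit_upd_smult:
  assumes "C \<in> {0..m} \<rightarrow> carrier_mat (2 ^ n) (2 ^ n)" "k \<in> {1..m} \<rightarrow> {1..n}"
    and "U \<in> {1..m} \<rightarrow> carrier_mat 2 2" "j \<in> {1..m}"
    and A: "A \<in> carrier_mat 2 2"
  shows "circuit n m C k (U(j := x \<cdot>\<^sub>m A)) = x \<cdot>\<^sub>m circuit n m C k (U(j := A))"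
  using assms(1-4)
proof (induction m)
  case (Suc m)
  let ?N = "(2::nat) ^ n"
  have C: "C (Suc m) \<in> carrier_mat ?N ?N"
    using Suc.prems by (auto simp: Pi_iff)
  have G: "on_qubit n (k (Suc m)) M \<in> carrier_mat ?N ?N" if "M \<in> carrier_mat 2 2" for M
    using Suc.prems that by (intro on_qubit_carrier) (auto simp: Pi_iff)
  have F: "circuit n m C k (U(j := A)) \<in> carrier_mat ?N ?N"
    using Suc.prems A by (intro circuit_carrier) (auto simp: Pi_iff)
  show ?case
  proof (cases "j = Suc m")
    case True
    have upd: "circuit n (Suc m) C k (U(j := M)) =
        C (Suc m) * on_qubit n (k (Suc m)) M * circuit n m C k U" for M
      by (simp only: True circuit.simps fun_upd_same circuit_upd_outside[OF lessI])
    have "circuit n m C k U \<in> carrier_mat ?N ?N"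
      using Suc.prems by (intro circuit_carrier) (auto simp: Pi_iff)
    then show ?thesis
      by (simp only: upd on_qubit_smult[OF A] mult_smult_distrib[OF C G[OF A]]
          mult_smult_assoc_mat[OF mult_carrier_mat[OF C G[OF A]]])
  next
    case False
    then have upd: "circuit n (Suc m) C k (U(j := M)) =
        C (Suc m) * on_qubit n (k (Suc m)) (U (Suc m)) * circuit n m C k (U(j := M))" for M
      by (simp add: fun_upd_other del: fun_upd_apply)
    have IH: "circuit n m C k (U(j := x \<cdot>\<^sub>m A)) = x \<cdot>\<^sub>m circuit n m C k (U(j := A))"
      using Suc.prems False by (intro Suc.IH) (auto simp: Pi_iff)
    have D: "C (Suc m) * on_qubit n (k (Suc m)) (U (Suc m)) \<in> carrier_mat ?N ?N"
      using Suc.prems by (intro mult_carrier_mat[OF C] G) (auto simp: Pi_iff)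
    show ?thesis
      by (simp only: upd IH mult_smult_distrib[OF D F])
  qed
qed auto

section \<open>The Pauli matrices span the 2 by 2 matrices\<close>

lemma paulis_carrier: "paulis \<subseteq> carrier_mat 2 2"
  by (auto simp: paulis_def pauli_X_def pauli_Y_def pauli_Z_def mat_of_rows_list_def)

text \<open>The coefficient of a Pauli matrix Q is tr(QA)/2, since the Pauli matrices are Hermitian
  and orthogonal for the trace inner product, each of squared norm 2.\<close>

lemma pauli_decomposition:
  assumes "A \<in> carrier_mat 2 2"
  shows "A = ((A $$ (0,0) + A $$ (1,1)) / 2) \<cdot>\<^sub>m 1\<^sub>m 2 + ((A $$ (0,1) + A $$ (1,0)) / 2) \<cdot>\<^sub>m pauli_X
    + ((A $$ (0,1) - A $$ (1,0)) * \<i> / 2) \<cdot>\<^sub>m pauli_Y + ((A $$ (0,0) - A $$ (1,1)) / 2) \<cdot>\<^sub>m pauli_Z"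
  (is "A = ?B")
proof (intro eq_matI)
  fix i j assume "i < dim_row ?B" "j < dim_col ?B"
  \<comment> \<open>A matrix sum takes its dimensions from its right summand, so those of
    \<open>?B\<close> are read off \<open>pauli_Z\<close>.\<close>
  then have "i \<in> {0, 1}" "j \<in> {0, 1}"
    by (auto simp: pauli_Z_def mat_of_rows_list_def)
  then show "A $$ (i, j) = ?B $$ (i, j)"
    by (auto simp: pauli_X_def pauli_Y_def pauli_Z_def mat_of_rows_list_def field_simps)
qed (use assms in \<open>auto simp: pauli_Z_def mat_of_rows_list_def\<close>)

text \<open>Spanning recast as an induction rule, so that extending an identity in one slot splits
  into a Pauli case and two linearity cases.\<close>

lemma pauli_span_induct [consumes 1, case_names pauli add smult]:
  assumes A: "A \<in> carrier_mat 2 2"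
    and pauli: "\<And>Q. Q \<in> paulis \<Longrightarrow> R Q"
    and add: "\<And>A B. A \<in> carrier_mat 2 2 \<Longrightarrow> B \<in> carrier_mat 2 2 \<Longrightarrow> R A \<Longrightarrow> R B \<Longrightarrow> R (A + B)"
    and smult: "\<And>x A. A \<in> carrier_mat 2 2 \<Longrightarrow> R A \<Longrightarrow> R (x \<cdot>\<^sub>m A)"
  shows "R A"
proof -
  \<comment> \<open>The dimensions are carried along with \<open>R\<close> so that the closure under
    sums can be chained through a four-term combination.\<close>
  have 1: "x \<cdot>\<^sub>m Q \<in> carrier_mat 2 2 \<and> R (x \<cdot>\<^sub>m Q)" if "Q \<in> paulis" for x Q
    using that paulis_carrier pauli smult by auto
  have 2: "A + B \<in> carrier_mat 2 2 \<and> R (A + B)"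
    if "A \<in> carrier_mat 2 2 \<and> R A" "B \<in> carrier_mat 2 2 \<and> R B" for A B
    using that add by auto
  have "R (a \<cdot>\<^sub>m 1\<^sub>m 2 + b \<cdot>\<^sub>m pauli_X + c \<cdot>\<^sub>m pauli_Y + d \<cdot>\<^sub>m pauli_Z)" for a b c d
    by (rule 2[OF 2[OF 2[OF 1 1] 1] 1, THEN conjunct2]) (auto simp: paulis_def)
  then show ?thesis
    using pauli_decomposition[OF A] by metis
qed

section \<open>Extension from Pauli gates to arbitrary gates\<close>

text \<open>The gates range over all 2 by 2 matrices rather than unitary ones, because the partial
  sums of a Pauli decomposition need not be unitary.\<close>

lemma circuit_eq_if_eq_on_paulis:
  assumes C: "C \<in> {0..m} \<rightarrow> carrier_mat (2 ^ n) (2 ^ n)" "k \<in> {1..m} \<rightarrow> {1..n}"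
    and C': "C' \<in> {0..m} \<rightarrow> carrier_mat (2 ^ n) (2 ^ n)" "l \<in> {1..m} \<rightarrow> {1..n}"
    and eq: "\<And>P. P \<in> {1..m} \<rightarrow> paulis \<Longrightarrow> circuit n m C' l P = z \<cdot>\<^sub>m circuit n m C k P"
    and U: "U \<in> {1..m} \<rightarrow> carrier_mat 2 2"
  shows "circuit n m C' l U = z \<cdot>\<^sub>m circuit n m C k U"
proof -
  \<comment> \<open>\<open>J\<close> is the set of slots already freed from the Pauli restriction:
    the empty set gives the hypothesis, and \<open>{1..m}\<close> gives the claim.\<close>
  have "circuit n m C' l U = z \<cdot>\<^sub>m circuit n m C k U"
    if "finite J" "J \<subseteq> {1..m}" "U \<in> {1..m} \<rightarrow> carrier_mat 2 2" "U \<in> {1..m} - J \<rightarrow> paulis" for J U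
    using that
  proof (induction J arbitrary: U rule: finite_induct)
    case empty
    then show ?case using eq by simp
  next
    case (insert j J)
    have j: "j \<in> {1..m}" and Uj: "U j \<in> carrier_mat 2 2"
      using insert.prems by auto
    \<comment> \<open>The content of slot \<open>j\<close> is generalised to any \<open>A\<close>
      and reduced to Pauli matrices. With a Pauli matrix there, only the slots in \<open>J\<close>
      are unrestricted, so the induction hypothesis applies. Taking \<open>A = U j\<close> recovers
      \<open>U\<close>.\<close>
    have "circuit n m C' l (U(j := A)) = z \<cdot>\<^sub>m circuit n m C k (U(j := A))"
      if "A \<in> carrier_mat 2 2" for A
      using that
    proof (induction A rule: pauli_span_induct)
      case (pauli Q)
      then show ?case
        using insert.prems paulis_carrier by (intro insert.IH) (auto simp: Pi_iff)
    next
      case (add A B)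
      have F: "circuit n m C k (U(j := M)) \<in> carrier_mat (2 ^ n) (2 ^ n)"
        if "M \<in> carrier_mat 2 2" for M
        using insert.prems that C by (intro circuit_carrier) (auto simp: Pi_iff)
      show ?case
        by (simp only: add.IH circuit_upd_add[OF C insert.prems(2) j add.hyps]
            circuit_upd_add[OF C' insert.prems(2) j add.hyps]
            add_smult_distrib_left_mat[OF F[OF add.hyps(1)] F[OF add.hyps(2)]])
    next
      case (smult x A)
      \<comment> \<open>The factor \<open>x\<close> drawn out of slot \<open>j\<close> has to be
        moved past the fixed factor \<open>z\<close>.\<close>
      have "x \<cdot>\<^sub>m (z \<cdot>\<^sub>m M) = z \<cdot>\<^sub>m (x \<cdot>\<^sub>m M)" for M
        by (intro eq_matI) auto
      then show ?case
        by (simp only: smult.IH circuit_upd_smult[OF C insert.prems(2) j smult.hyps]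
            circuit_upd_smult[OF C' insert.prems(2) j smult.hyps])
    qed
    from this[OF Uj] show ?case by simp
  qed
  from this[of "{1..m}" U] U show ?thesis by simp
qed

text \<open>Provides the witness for the existential half of the theorem: the assignment with the
  identity in every slot.\<close>

lemma one_unitary: "1\<^sub>m d \<in> unitary_matrices d"
proof -
  have "mat_adjoint (1\<^sub>m d) = (1\<^sub>m d :: complex mat)"
    by (intro eq_matI) (auto simp: mat_adjoint_def mat_of_rows_def)
  then show ?thesis by (simp add: unitary_matrices_def)
qed

theorem lemma12:
  fixes n m :: nat
    and C C' :: "nat \<Rightarrow> complex mat"
    and k l :: "nat \<Rightarrow> nat"
    and \<phi> :: real
  assumes "n \<ge> 1" and "m \<ge> 1"
    and "C \<in> {0..m} \<rightarrow> clifford_gates n"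
    and "C' \<in> {0..m} \<rightarrow> clifford_gates n"
    and "k \<in> {1..m} \<rightarrow> {1..n}"
    and "l \<in> {1..m} \<rightarrow> {1..n}"
    and "\<forall>P \<in> {1..m} \<rightarrow> paulis.
           circuit n m C' l P = exp (\<i> * complex_of_real \<phi>) \<cdot>\<^sub>m circuit n m C k P"
  shows "(\<forall>U \<in> {1..m} \<rightarrow> unitary_matrices 2.
            circuit n m C' l U = exp (\<i> * complex_of_real \<phi>) \<cdot>\<^sub>m circuit n m C k U) \<and>
         (\<exists>U \<in> {1..m} \<rightarrow> unitary_matrices 2.
            circuit n m C' l U = exp (\<i> * complex_of_real \<phi>) \<cdot>\<^sub>m circuit n m C k U)"
proof -
  have C: "C \<in> {0..m} \<rightarrow> carrier_mat (2 ^ n) (2 ^ n)" "C' \<in> {0..m} \<rightarrow> carrier_mat (2 ^ n) (2 ^ n)"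
    using assms(3,4) by (auto simp: clifford_gates_def unitary_matrices_def Pi_iff)
  have "circuit n m C' l U = exp (\<i> * complex_of_real \<phi>) \<cdot>\<^sub>m circuit n m C k U"
    if "U \<in> {1..m} \<rightarrow> unitary_matrices 2" for U
  proof (rule circuit_eq_if_eq_on_paulis[OF C(1) assms(5) C(2) assms(6)])
    show "U \<in> {1..m} \<rightarrow> carrier_mat 2 2"
      using that by (auto simp: unitary_matrices_def Pi_iff)
  qed (use assms(7) in blast)
  moreover have "(\<lambda>_. 1\<^sub>m 2) \<in> {1..m} \<rightarrow> unitary_matrices 2"
    using one_unitary by simp
  ultimately show ?thesis by blast
qed

end
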